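(* Let $\{T_k\}_{k\ge 1}$ be an arbitrary sequence of real numbers with $T_k\ge 0$, and let $0<p<1$. Let $\mu$ be the probability distribution on $\mathcal{T}$ of the geometric random tree $\mathcal{G}(T_k,p)$. Then $\mu$ is invariant with respect to the Horton pruning $\mathcal{R}$; that is, with $\nu(T):=\mu(\mathcal{R}^{-1}(T))$, one has $$\nu\left(T \mid T\neq\phi\right)=\mu(T)\qquad\text{for every } T\in\mathcal{T}.$$
   Context: **Trees.** $\mathcal{T}$ is the space of finite unlabeled rooted reduced binary trees with no planar embedding (no left/right order among siblings), including the empty tree $\phi$ consisting of a single root vertex and no edges. Reduced means there are no vertices of degree 2. Nonempty trees are planted: the root has degree 1 (it is the end of a root edge and is not counted as a leaf), every other vertex is either a leaf or has exactly two offspring. The smallest nonempty tree consists of two vertices (root and leaf) joined by one edge. **Pruning.** $\mathcal{R}:\mathcal{T}\to\mathcal{T}$ is defined by $\mathcal{R}(\phi)=\phi$ and, for $T\ne\phi$, $\mathcal{R}(T)$ is obtained from $T$ by removing all leaves and their parental edges, followed by series reduction (removing the resulting non-root vertices of degree 2 and merging their two adjacent edges). **Orders.** The Horton-Strahler order of a tree is $\mathrm{ord}(T)=\min\{k\ge 0:\mathcal{R}^k(T)=\phi\}$. The order of a non-root vertex $v$ of $T$, and of its parental edge, is the order of the descendant subtree $T_v$ consisting of all descendants of $v$ (including $v$) together with their parental edges. A branch is a (maximal) collection of adjacent vertices/edges of the same order. A side branch of order $i$ within a branch of order $j>i$ is a branch of order $i$ that merges with that branch of order $j$; two branches of the same order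 that merge to form a branch of higher order are not side branches. **Geometric distribution.** $X\stackrel{d}{=}\mathsf{Geom}(r)$ means $\mathrm{Prob}(X=k)=r(1-r)^k$, $k=0,1,2,\dots$. **Geometric tree.** Given $\{T_k\ge 0\}_{k\ge1}$ and $0<p<1$, put $S_0=1$ and $S_K=1+T_1+\dots+T_K$ for $K\ge1$, and $p_{K,j}=\dfrac{T_{K-j}}{T_1+\dots+T_{K-1}}$ for $1\le j\le K-1$ (needed only when the denominator is nonzero). The random tree $\mathcal{G}(T_k,p)\in\mathcal{T}$ is defined by: (i) $\mathrm{ord}(\mathcal{G})-1\stackrel{d}{=}\mathsf{Geom}(p)$; (ii) the total number $m_K$ of side branches within a branch of order $K\ge2$ is $\mathsf{Geom}(S_{K-1}^{-1})$ (branches of order 1 have no side branches); (iii) for a branch of order $K\ge 2$, conditioned on $m_K=m$, the orders of the $m$ side branches are assigned according to the multinomial distribution with $m$ trials and success probabilities $p_{K,j}$, $j=1,\dots,K-1$ (i.e. the successive side branches along the branch have independent orders with law $p_{K,\cdot}$); (iv) the numbers of side branches and their orders are independent in distinct branches. Equivalently, a random tree of order $1$ is a single edge; a random tree of order $K\ge2$ consists of a branch of order $K$ starting at the root, with $m_K$ successive side branches, each of which begins an independent random tree of its assigned order, and which ends at a vertex where two independent random trees of order $K-1$ are attached. *)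

theory Defs
  imports "HOL-Probability.Probability"
begin

(* The children of a vertex form a multiset, so siblings carry no order. *)
datatype rtree = Vertex (offspring: "rtree multiset")

abbreviation is_leaf :: "rtree \<Rightarrow> bool" where
  "is_leaf t \<equiv> offspring t = {#}"

definition empty_tree :: rtree where
  "empty_tree = Vertex {#}"

inductive full_binary :: "rtree \<Rightarrow> bool" where
  leaf: "full_binary (Vertex {#})"
| fork: "full_binary a \<Longrightarrow> full_binary b \<Longrightarrow> full_binary (Vertex {#a, b#})"

(* The outermost vertex is the root.  In a nonempty tree it has exactly one child, and the
   edge to that child is the root edge. *)
definition binary_trees :: "rtree set" where
  "binary_trees = insert empty_tree {Vertex {#t#} | t. full_binary t}"

(* The outermost vertex itself is never deleted, so the root does not count as a leaf. *)
function cut_leaves :: "rtree \<Rightarrow> rtree" where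
  "cut_leaves (Vertex M) = Vertex (image_mset cut_leaves {#t \<in># M. \<not> is_leaf t#})"
  by pat_completeness auto
termination
  by (relation "Wellfounded.measure size") (auto dest!: multi_member_split)

(* A non-root vertex has degree 2 iff it has exactly one child. *)
primrec merge_unary :: "rtree \<Rightarrow> rtree" where
  "merge_unary (Vertex M) =
     (if size M = 1 then the_elem (set_mset (image_mset merge_unary M))
      else Vertex (image_mset merge_unary M))"

definition series_reduce :: "rtree \<Rightarrow> rtree" where
  "series_reduce t = Vertex (image_mset merge_unary (offspring t))"

definition prune :: "rtree \<Rightarrow> rtree" where
  "prune t = series_reduce (cut_leaves t)"

definition horton_order :: "rtree \<Rightarrow> nat" where
  "horton_order t = (LEAST k. (prune ^^ k) t = empty_tree)"

definition S_coeff :: "(nat \<Rightarrow> real) \<Rightarrow> nat \<Rightarrow> real" where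
  "S_coeff T K = 1 + (\<Sum>k=1..K. T k)"

definition side_order_pmf :: "(nat \<Rightarrow> real) \<Rightarrow> nat \<Rightarrow> nat pmf" where
  "side_order_pmf T K =
     embed_pmf (\<lambda>j. if 1 \<le> j \<and> j \<le> K - 1 then T (K - j) / (\<Sum>k=1..K - 1. T k) else 0)"

definition planted_edge :: rtree where
  "planted_edge = Vertex {#Vertex {#}#}"

(* Identify the roots of two planted trees and plant the result on a new root edge. *)
definition join :: "rtree \<Rightarrow> rtree \<Rightarrow> rtree" where
  "join A B = Vertex {#Vertex (offspring A + offspring B)#}"

(* Law of the tree conditioned to have order K.  The test j < K is there for termination;
   it always succeeds when T is nonnegative and T 1 + ... + T (K - 1) > 0.  If that sum is 0,
   side_order_pmf T K is unspecified, but then S_coeff T (K - 1) = 1, hence m = 0 almost surely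
   and it is never sampled. *)
fun tree_of_order :: "(nat \<Rightarrow> real) \<Rightarrow> nat \<Rightarrow> rtree pmf" where
  "tree_of_order T K =
     (if K = 0 then return_pmf empty_tree
      else if K = 1 then return_pmf planted_edge
      else do {
        m \<leftarrow> geometric_pmf (inverse (S_coeff T (K - 1)));
        sides \<leftarrow> replicate_pmf m (do {
          j \<leftarrow> side_order_pmf T K;
          if j < K then tree_of_order T j else return_pmf empty_tree
        });
        a \<leftarrow> tree_of_order T (K - 1);
        b \<leftarrow> tree_of_order T (K - 1);
        return_pmf (foldr join sides (join a b))
      })"

declare tree_of_order.simps [simp del]

definition geometric_tree :: "(nat \<Rightarrow> real) \<Rightarrow> real \<Rightarrow> rtree pmf" where
  "geometric_tree T p = do { k \<leftarrow> geometric_pmf p; tree_of_order T (k + 1) }"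

(* The facts below show that the construction is as intended: the random tree is a nonempty
   element of binary_trees, side branch orders have the law T (K - j) / (T 1 + ... + T (K - 1)),
   and the Horton-Strahler order of the random tree minus 1 is geometric with parameter p.
   is_ord n A states that n is the least k with (prune ^^ k) A = empty_tree, including that
   such a k exists, which LEAST alone does not give. *)
primrec is_ord :: "nat \<Rightarrow> rtree \<Rightarrow> bool" where
  "is_ord 0 A \<longleftrightarrow> A = empty_tree"
| "is_ord (Suc n) A \<longleftrightarrow> A \<noteq> empty_tree \<and> is_ord n (prune A)"

lemma is_ord_iff: "is_ord n A \<longleftrightarrow> (prune ^^ n) A = empty_tree \<and> (\<forall>m<n. (prune ^^ m) A \<noteq> empty_tree)"
proof (induction n arbitrary: A)
  case (Suc n)
  have "(\<forall>m<Suc n. (prune ^^ m) A \<noteq> empty_tree) \<longleftrightarrow> A \<noteq> empty_tree \<and> (\<forall>m<n. (prune ^^ m) (prune A) \<noteq> empty_tree)"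
    by (auto simp: All_less_Suc2 funpow_Suc_right simp del: funpow.simps(2))
  then show ?case using Suc by (auto simp: funpow_Suc_right simp del: funpow.simps(2))
qed auto

lemma is_ord_horton: "is_ord n A \<Longrightarrow> horton_order A = n"
  unfolding horton_order_def is_ord_iff by (intro Least_equality) (auto simp: not_less[symmetric])

lemma prune_empty: "prune empty_tree = empty_tree"
  by (simp add: prune_def series_reduce_def empty_tree_def)

lemma prune_planted: 
  "prune (Vertex {#a#}) = (if is_leaf a then empty_tree else Vertex {#merge_unary (cut_leaves a)#})"
  by (simp add: prune_def series_reduce_def empty_tree_def)

lemma merge_cut_fork: "merge_unary (cut_leaves (Vertex {#a,b#})) =
  (if is_leaf a then if is_leaf b then Vertex {#} else merge_unary (cut_leaves b)
   else if is_leaf b then merge_unary (cut_leaves a)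
   else Vertex {#merge_unary (cut_leaves a), merge_unary (cut_leaves b)#})"
  by (auto simp: add_mset_commute)

lemma full_binary_prune: "full_binary a \<Longrightarrow> full_binary (merge_unary (cut_leaves a))"
proof (induction rule: full_binary.induct)
  case leaf then show ?case by (auto intro: full_binary.intros)
next
  case (fork a b) then show ?case unfolding merge_cut_fork by (auto intro: full_binary.intros)
qed

lemma prune_closed: "A \<in> binary_trees \<Longrightarrow> prune A \<in> binary_trees"
  by (auto simp: binary_trees_def prune_empty prune_planted full_binary_prune)

lemma join_planted: "join (Vertex {#a#}) (Vertex {#b#}) = Vertex {#Vertex {#a,b#}#}"
  by (simp add: join_def)

lemma join_closed:
  "A \<in> binary_trees \<Longrightarrow> A \<noteq> empty_tree \<Longrightarrow> B \<in> binary_trees \<Longrightarrow> B \<noteq> empty_tree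
   \<Longrightarrow> join A B \<in> binary_trees \<and> join A B \<noteq> empty_tree"
  by (auto simp: binary_trees_def join_planted full_binary.intros empty_tree_def)

lemma prune_join: "A \<in> binary_trees \<Longrightarrow> A \<noteq> empty_tree \<Longrightarrow> B \<in> binary_trees \<Longrightarrow> B \<noteq> empty_tree \<Longrightarrow>
  prune (join A B) = (if prune A = empty_tree then if prune B = empty_tree then planted_edge else prune B
    else if prune B = empty_tree then prune A else join (prune A) (prune B))"
  by (auto simp: binary_trees_def join_planted prune_planted merge_cut_fork planted_edge_def
    simp del: cut_leaves.simps merge_unary.simps) (auto simp: empty_tree_def)

lemma is_ord_planted_edge: "is_ord (Suc 0) planted_edge" "planted_edge \<in> binary_trees"
  by (auto simp: planted_edge_def prune_planted empty_tree_def binary_trees_def full_binary.intros)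

lemma is_ord_join: "A \<in> binary_trees \<Longrightarrow> B \<in> binary_trees \<Longrightarrow> is_ord (Suc m) A \<Longrightarrow> is_ord (Suc n) B
  \<Longrightarrow> is_ord (if m = n then Suc (Suc m) else Suc (max m n)) (join A B)"
proof (induction m arbitrary: n A B)
  case 0
  show ?case using 0 join_closed[of A B] is_ord_planted_edge prune_join[of A B]
    by (cases n) (auto simp: max_def)
next
  case (Suc m)
  show ?case
  proof (cases n)
    case 0 then show ?thesis using Suc.prems join_closed[of A B] prune_join[of A B]  by (auto simp: max_def)
  next
    case (Suc n')
    then have "is_ord (if m = n' then Suc (Suc m) else Suc (max m n')) (join (prune A) (prune B))"
      using Suc.prems by (intro Suc.IH prune_closed) auto
    then show ?thesis using Suc Suc.prems join_closed[of A B] prune_join[of A B] by (auto split: if_splits)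
  qed
qed

lemma pmf_side_order:
  assumes "\<And>k. 1 \<le> k \<Longrightarrow> 0 \<le> T k" "(\<Sum>k=1..K - 1. T k) \<noteq> (0::real)"
  shows "pmf (side_order_pmf T K) j = (if 1 \<le> j \<and> j \<le> K - 1 then T (K - j) / (\<Sum>k=1..K - 1. T k) else 0)"
  unfolding side_order_pmf_def
proof (rule pmf_embed_pmf, goal_cases)
  case (1 x)
  then show ?case using assms(1) by (auto intro!: divide_nonneg_nonneg sum_nonneg)
next
  case 2
  let ?f = "\<lambda>j. if 1 \<le> j \<and> j \<le> K - 1 then T (K - j) / (\<Sum>k=1..K - 1. T k) else 0"
  have nn: "?f x \<ge> 0" for x using assms(1) by (auto intro!: divide_nonneg_nonneg sum_nonneg)
  have "(\<integral>\<^sup>+ x. ennreal (?f x) \<partial>count_space UNIV) = (\<Sum>j\<in>{1..K-1}. ennreal (?f j))"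
    by (intro nn_integral_count_space') (auto simp: if_splits)
  also have "\<dots> = ennreal (\<Sum>j\<in>{1..K-1}. ?f j)" by (rule sum_ennreal) (rule nn)
  also have "(\<Sum>j\<in>{1..K-1}. ?f j) = (\<Sum>j\<in>{1..K-1}. T (K - j)) / (\<Sum>k=1..K - 1. T k)"
    unfolding sum_divide_distrib by (intro sum.cong) auto
  also have "(\<Sum>j\<in>{1..K-1}. T (K - j)) = (\<Sum>k=1..K - 1. T k)"
    by (rule sum.reindex_bij_witness[of _ "\<lambda>j. K - j" "\<lambda>j. K - j"]) auto
  finally show ?case using assms by simp
qed

lemma tree_of_order_support:
  assumes T: "\<And>k. 1 \<le> k \<Longrightarrow> 0 \<le> T k"
  shows "t \<in> set_pmf (tree_of_order T K) \<Longrightarrow> t \<in> binary_trees \<and> is_ord K t"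
proof (induction K arbitrary: t rule: less_induct)
  case (less K)
  consider "K = 0" | "K = 1" | "K \<ge> 2" by linarith
  then show ?case
  proof cases
    case 1 then show ?thesis using less.prems by (auto simp: tree_of_order.simps[of T 0] binary_trees_def)
  next
    case 2 then show ?thesis using less.prems is_ord_planted_edge
      by (auto simp: tree_of_order.simps[of T 1] tree_of_order.simps[of T "Suc 0"])
  next
    case 3
    define side where
      "side = (side_order_pmf T K \<bind> (\<lambda>j. if j < K then tree_of_order T j else return_pmf empty_tree))"
    from less.prems 3 obtain m sides a b where *:
      "m \<in> set_pmf (geometric_pmf (inverse (S_coeff T (K - 1))))"
      "sides \<in> set_pmf (replicate_pmf m side)"
      "a \<in> set_pmf (tree_of_order T (K-1))" "b \<in> set_pmf (tree_of_order T (K-1))"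
      "t = foldr join sides (join a b)"
      by (auto simp: tree_of_order.simps[of T K] side_def)
    have ab: "a \<in> binary_trees" "b \<in> binary_trees" "is_ord (K-1) a" "is_ord (K-1) b"
      using less.IH[of "K-1"] * 3 by auto
    have base: "join a b \<in> binary_trees" "is_ord K (join a b)"
      using is_ord_join[of a b "K-2" "K-2"] join_closed[of a b] ab 3
      by (auto simp: numeral_2_eq_2 Suc_diff_Suc) (cases "K - 1"; auto)+
    have sides: "\<exists>j. 1 \<le> j \<and> j < K \<and> is_ord j s \<and> s \<in> binary_trees" if "s \<in> set sides" for s
    proof -
      have ne: "(\<Sum>k=1..K - 1. T k) \<noteq> 0"
      proof
        assume "(\<Sum>k=1..K - 1. T k) = 0"
        then have "m = 0" using *(1) by (simp add: S_coeff_def)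
        then show False using that *(2) by simp
      qed
      have "s \<in> set_pmf side" using that *(2) by (auto simp: set_replicate_pmf)
      then obtain j where j: "j \<in> set_pmf (side_order_pmf T K)"
        "s \<in> set_pmf (if j < K then tree_of_order T j else return_pmf empty_tree)"
        unfolding side_def by auto
      have "pmf (side_order_pmf T K) j \<noteq> 0" using j(1) by (simp add: set_pmf_iff)
      then have "1 \<le> j" "j < K" using 3 pmf_side_order[OF T ne, of j]
        by (auto split: if_splits simp del: One_nat_def)
      moreover from this have "s \<in> set_pmf (tree_of_order T j)" using j(2) by simp
      ultimately show ?thesis using less.IH[of j s] by auto
    qed
    have "foldr join sides (join a b) \<in> binary_trees \<and> is_ord K (foldr join sides (join a b))"
      using sides
    proof (induction sides)
      case Nil then show ?case using base by simp
    next
      case (Cons s ss)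
      then obtain j where j: "1 \<le> j" "j < K" "is_ord j s" "s \<in> binary_trees" by auto
      let ?u = "foldr join ss (join a b)"
      have u: "?u \<in> binary_trees" "is_ord K ?u" using Cons by auto
      obtain j' K' where jk: "j = Suc j'" "K = Suc K'" using j by (cases j; cases K) auto
      show ?case using is_ord_join[of s ?u j' K'] j u jk join_closed[of s ?u]
        by (auto simp: max_def split: if_splits)
    qed
    then show ?thesis using * by simp
  qed
qed

lemma geometric_tree_support:
  assumes "\<And>k. 1 \<le> k \<Longrightarrow> 0 \<le> T k"
  shows "set_pmf (geometric_tree T p) \<subseteq> binary_trees - {empty_tree}"
    and "map_pmf horton_order (geometric_tree T p) = map_pmf Suc (geometric_pmf p)"
proof -
  show "set_pmf (geometric_tree T p) \<subseteq> binary_trees - {empty_tree}"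
    using tree_of_order_support[of T] assms by (fastforce simp: geometric_tree_def)
  have "map_pmf horton_order (tree_of_order T (k+1)) = return_pmf (Suc k)" for k
  proof -
    have "map_pmf horton_order (tree_of_order T (k+1)) = map_pmf (\<lambda>_. Suc k) (tree_of_order T (k+1))"
      using tree_of_order_support[of T] assms by (intro map_pmf_cong refl is_ord_horton) fastforce
    then show ?thesis by simp
  qed
  then show "map_pmf horton_order (geometric_tree T p) = map_pmf Suc (geometric_pmf p)"
    unfolding geometric_tree_def map_bind_pmf by (simp add: map_pmf_def)
qed

end

theory Submission
  imports Defs
begin

text \<open>
  Fix the order instead of randomizing it, and let \<open>\<sigma> K = T 1 + ... + T (K - 1)\<close>, which is the mean
  number of side branches of a branch of order \<open>K\<close>. The heart of the matter is that pruning a random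
  tree of order \<open>K + 1\<close> gives a random tree of order \<open>K\<close> (\<open>prune_tree_of_order\<close>), by strong induction
  on \<open>K\<close>.

  Cutting the leaves acts separately on the pieces attached along the leading branch: each of the two
  final subtrees (for \<open>K \<ge> 2\<close>) and each side branch is pruned in place, and a side branch that is a single edge
  disappears together with its attachment vertex (\<open>prune_foldr_join\<close>). By the induction hypothesis,
  the surviving side branches are random trees with orders lowered by one. Two facts remain, both about
  the list of side branches.

  \<^item> An independent thinning of a geometric number of trials is again geometric, and the
    survivors are independent with the conditional law (\<open>filter_geometric_list\<close>).

  \<^item> The weight \<open>T (K + 1 - j)\<close> of side branches of order \<open>j\<close> depends only on the difference of
    orders. Lowering both orders by one therefore preserves the weights, and only the term \<open>T K\<close> of the
    side branches of order 1 is lost, which turns the total weight \<open>\<sigma> (K + 1)\<close> into \<open>\<sigma> K\<close>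
    (\<open>prune_side_branches\<close>).

  The theorem then follows from the lack of memory of the order: the pruned tree is empty with
  probability \<open>p\<close>, and given that it is not, its order minus 1 is geometric with parameter \<open>p\<close> again.
\<close>

section \<open>Thinning a geometric number of independent trials\<close>

text \<open>
  The parameter \<open>a\<close> is the mean length of the list. With it, the success probability
  \<open>1 / S_coeff T (K - 1)\<close> corresponds to the total side branch weight \<open>T 1 + ... + T (K - 1)\<close>,
  and the thinning condition below needs no division.
\<close>
definition geometric_list :: "real \<Rightarrow> 'a pmf \<Rightarrow> 'a list pmf" where
  "geometric_list a X = geometric_pmf (inverse (1 + a)) \<bind> (\<lambda>m. replicate_pmf m X)"

lemma geometric_list_unfold:
  assumes "0 \<le> a"
  shows "geometric_list a X = bernoulli_pmf (inverse (1 + a)) \<bind>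
    (\<lambda>b. if b then return_pmf [] else X \<bind> (\<lambda>x. map_pmf ((#) x) (geometric_list a X)))"
proof -
  have p: "inverse (1 + a) \<in> {0<..1}"
    using assms by (auto simp: field_simps)
  have "map_pmf Suc (geometric_pmf (inverse (1 + a))) \<bind> (\<lambda>m. replicate_pmf m X)
     = X \<bind> (\<lambda>x. map_pmf ((#) x) (geometric_list a X))"
    unfolding geometric_list_def map_bind_pmf bind_map_pmf
    by (simp add: map_pmf_def) (rule bind_commute_pmf)
  then show ?thesis
    unfolding geometric_list_def
    by (subst geometric_bind_pmf_unfold[OF p])
      (auto simp: bind_assoc_pmf bind_return_pmf map_bind_pmf intro!: bind_pmf_cong)
qed

lemma map_geometric_list:
  "map_pmf (map f) (geometric_list a X) = geometric_list a (map_pmf f X)"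
proof -
  have "map_pmf (map f) (replicate_pmf m X) = replicate_pmf m (map_pmf f X)" for m
  proof (induction m)
    case (Suc m)
    show ?case
      by (simp add: map_bind_pmf bind_map_pmf Suc[symmetric])
  qed simp
  then show ?thesis
    by (simp add: geometric_list_def map_bind_pmf)
qed

lemma set_geometric_list:
  assumes "0 \<le> a" "xs \<in> set_pmf (geometric_list a X)" "x \<in> set xs"
  shows "a \<noteq> 0" "x \<in> set_pmf X"
  using assms by (auto simp: geometric_list_def set_replicate_pmf)

text \<open>
  Conditioning on the first trial: the list stops, or its first element survives and is followed by a
  fresh copy of the filtered list, or it is dropped and the filtered list starts afresh. The last case
  reproduces the unknown on the right, and solving for it gives the factor \<open>c\<close>. The two
  equations determine the law of the filtered list by induction on the outcome.
\<close>
lemma pmf_filter_geometric_list: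
  fixes X :: "'a pmf" and P :: "'a \<Rightarrow> bool"
  assumes a: "0 \<le> a"
  defines "F \<equiv> map_pmf (filter P) (geometric_list a X)"
    and "c \<equiv> 1 + a * measure_pmf.prob X {x. P x}"
  shows "c * pmf F [] = 1"
    and "c * pmf F (y # ys) = a * (if P y then pmf X y else 0) * pmf F ys"
proof -
  let ?g = "\<lambda>x. if P x then map_pmf ((#) x) F else F"
  have F: "F = bernoulli_pmf (inverse (1 + a)) \<bind>
      (\<lambda>b. if b then return_pmf [] else X \<bind> ?g)"
    unfolding F_def
    by (subst geometric_list_unfold[OF a])
      (auto simp: map_bind_pmf pmf.map_comp o_def intro!: bind_pmf_cong)
  have p: "0 \<le> inverse (1 + a)" "inverse (1 + a) \<le> 1"
    using a by (auto simp: field_simps)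
  have step: "(1 + a) * pmf F zs = (if zs = [] then 1 else 0) + a * pmf (X \<bind> ?g) zs" for zs
  proof -
    have "pmf F zs = (if zs = [] then 1 else 0) * inverse (1 + a)
        + pmf (X \<bind> ?g) zs * (1 - inverse (1 + a))"
      by (subst F, subst pmf_bind, subst integral_bernoulli_pmf[OF p]) (auto simp: pmf_return)
    moreover have "(1 + a) * inverse (1 + a) = 1"
      using a by simp
    ultimately show ?thesis by algebra
  qed
  have compl: "measure_pmf.prob X {x. \<not> P x} = 1 - measure_pmf.prob X {x. P x}"
    using measure_pmf.prob_compl[of "{x. P x}" X] by (simp add: Compl_eq_Diff_UNIV[symmetric] Collect_neg_eq)
  \<comment> \<open>As functions of the first trial, the point masses are combinations of indicators.\<close>
  have nil: "pmf (?g x) [] = pmf F [] * indicator {x. \<not> P x} x" for x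
    by (auto simp: indicator_def pmf_eq_0_set_pmf)
  have "pmf (X \<bind> ?g) [] = pmf F [] * (1 - measure_pmf.prob X {x. P x})"
    unfolding pmf_bind nil compl[symmetric] by simp
  with step[of "[]"] show "c * pmf F [] = 1"
    by (simp add: c_def algebra_simps)
  have map_Cons: "pmf (map_pmf ((#) x) F) (y # ys) = (if x = y then pmf F ys else 0)" for x
  proof (cases "x = y")
    case True
    have "inj ((#) y)" by (auto intro: injI)
    then show ?thesis using True by (simp add: pmf_map_inj')
  qed (auto simp: pmf_eq_0_set_pmf)
  have Cons: "pmf (?g x) (y # ys) = (if P y then pmf F ys else 0) * indicator {y} x
      + pmf F (y # ys) * indicator {x. \<not> P x} x" for x
    by (auto simp: indicator_def map_Cons)
  have "pmf (X \<bind> ?g) (y # ys) = (if P y then pmf X y else 0) * pmf F ys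
      + pmf F (y # ys) * (1 - measure_pmf.prob X {x. P x})"
    unfolding pmf_bind Cons compl[symmetric]
    by (subst Bochner_Integration.integral_add)
      (auto simp: measure_pmf_single intro!: measure_pmf.integrable_const_bound[where B=1])
  with step[of "y # ys"] show "c * pmf F (y # ys) = a * (if P y then pmf X y else 0) * pmf F ys"
    by (simp add: c_def algebra_simps)
qed

text \<open>
  The hypothesis compares unnormalized weights, so that it also covers \<open>b = 0\<close>, where nothing
  survives and \<open>Y\<close> is arbitrary. Summing it over \<open>x\<close> shows that \<open>b\<close> is the mean number of survivors;
  the filtered list and \<open>geometric_list b Y\<close> then satisfy the same first-step recursion.
\<close>
lemma filter_geometric_list:
  assumes "0 \<le> a" "0 \<le> b"
    and dens: "\<And>x. a * (if P x then pmf X x else 0) = b * pmf Y x"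
  shows "map_pmf (filter P) (geometric_list a X) = geometric_list b Y"
proof -
  let ?F = "map_pmf (filter P) (geometric_list a X)"
  have "ennreal a * emeasure (measure_pmf X) {x. P x}
      = (\<integral>\<^sup>+x. ennreal (a * (if P x then pmf X x else 0)) \<partial>count_space UNIV)"
    unfolding nn_integral_pmf[symmetric] using assms(1)
    by (subst nn_integral_cmult[symmetric])
      (auto simp: nn_integral_count_space_indicator ennreal_mult intro!: nn_integral_cong)
  also have "\<dots> = ennreal b"
    unfolding dens using assms(2) by (simp add: ennreal_mult nn_integral_cmult nn_integral_pmf)
  finally have mass: "a * measure_pmf.prob X {x. P x} = b"
    using assms(1,2) by (simp add: measure_pmf.emeasure_eq_measure ennreal_mult[symmetric])
  note F = pmf_filter_geometric_list[OF assms(1), where P = P and X = X, unfolded mass dens]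
  have "map_pmf (filter (\<lambda>_. True)) (geometric_list b Y) = geometric_list b Y"
    by (simp add: map_pmf_ident cong: map_pmf_cong)
  note G = pmf_filter_geometric_list[OF assms(2), where P = "\<lambda>_. True" and X = Y, simplified this, simplified]
  have b: "1 + b \<noteq> 0" using assms(2) by simp
  have "pmf ?F xs = pmf (geometric_list b Y) xs" for xs
  proof (induction xs)
    case Nil
    have "(1 + b) * pmf ?F [] = (1 + b) * pmf (geometric_list b Y) []"
      using F(1) G(1) by simp
    with b show ?case by simp
  next
    case (Cons x xs)
    have "(1 + b) * pmf ?F (x # xs) = (1 + b) * pmf (geometric_list b Y) (x # xs)"
      using F(2) G(2) Cons by simp
    with b show ?case by simp
  qed
  then show ?thesis by (intro pmf_eqI)
qed

section \<open>Pruning along the leading branch\<close>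

definition nonempty_trees :: "rtree set" where
  "nonempty_trees = binary_trees - {empty_tree}"

lemma join_not_empty_tree: "join A B \<noteq> empty_tree"
  by (simp add: join_def empty_tree_def)

lemma join_nonempty:
  "A \<in> nonempty_trees \<Longrightarrow> B \<in> nonempty_trees \<Longrightarrow> join A B \<in> nonempty_trees"
  using join_closed by (auto simp: nonempty_trees_def)

lemma foldr_join_nonempty:
  "set As \<subseteq> nonempty_trees \<Longrightarrow> B \<in> nonempty_trees \<Longrightarrow> foldr join As B \<in> nonempty_trees"
  by (induction As) (auto simp: join_nonempty)

text \<open>
  The leading branch itself survives because its end \<open>B\<close> does: every joint then keeps at least one of its
  two subtrees, so a pruned side branch is either joined again or, if it has vanished, its joint has
  degree 2 and is merged away.
\<close>
lemma prune_foldr_join: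
  assumes "set As \<subseteq> nonempty_trees" "B \<in> nonempty_trees" "prune B \<noteq> empty_tree"
  shows "prune (foldr join As B) = foldr join (filter (\<lambda>A. A \<noteq> empty_tree) (map prune As)) (prune B)"
proof -
  have "prune (foldr join As B) = foldr join (filter (\<lambda>A. A \<noteq> empty_tree) (map prune As)) (prune B)
      \<and> prune (foldr join As B) \<noteq> empty_tree"
    using assms(1)
  proof (induction As)
    case (Cons A As)
    let ?U = "foldr join As B"
    have "A \<in> nonempty_trees" "?U \<in> nonempty_trees"
      using Cons.prems assms(2) by (auto intro: foldr_join_nonempty)
    then show ?case
      using Cons prune_join[of A ?U]
      by (auto simp: nonempty_trees_def join_not_empty_tree)
  qed (use assms(3) in simp)
  then show ?thesis ..
qed

section \<open>Pruning a random tree of given order\<close>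

definition side_branch :: "(nat \<Rightarrow> real) \<Rightarrow> nat \<Rightarrow> rtree pmf" where
  "side_branch T K = side_order_pmf T K \<bind>
     (\<lambda>j. if j < K then tree_of_order T j else return_pmf empty_tree)"

lemma tree_of_order_branch:
  "tree_of_order T (Suc (Suc K)) =
     geometric_list (\<Sum>k=1..Suc K. T k) (side_branch T (Suc (Suc K))) \<bind> (\<lambda>sides.
     tree_of_order T (Suc K) \<bind> (\<lambda>a. tree_of_order T (Suc K) \<bind> (\<lambda>b.
     return_pmf (foldr join sides (join a b)))))"
  by (subst tree_of_order.simps)
    (simp add: geometric_list_def side_branch_def S_coeff_def bind_assoc_pmf del: sum.cl_ivl_Suc)

lemma tree_of_order_one: "tree_of_order T (Suc 0) = return_pmf planted_edge"
  by (simp add: tree_of_order.simps)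

context
  fixes T :: "nat \<Rightarrow> real"
  assumes T_nonneg: "\<And>k. 1 \<le> k \<Longrightarrow> 0 \<le> T k"
begin

lemma tree_of_order_nonempty:
  assumes "t \<in> set_pmf (tree_of_order T (Suc K))"
  shows "t \<in> nonempty_trees"
  using tree_of_order_support[of T, OF T_nonneg assms] by (auto simp: nonempty_trees_def)

text \<open>
  Multiplying by the total weight makes the law of a side branch a plain weighted sum. When the total
  weight is 0, the law of the order of a side branch is unspecified, but both sides vanish. The map
  \<open>f\<close> is the identity for the target law and \<open>prune\<close> for the pruned one.
\<close>
lemma pmf_map_side_branch:
  "(\<Sum>k=1..K. T k) * pmf (map_pmf f (side_branch T (Suc K))) x
     = (\<Sum>j=1..K. T (Suc K - j) * pmf (map_pmf f (tree_of_order T j)) x)"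
proof (cases "(\<Sum>k=1..K. T k) = 0")
  case True
  then have zero: "T k = 0" if "k \<in> {1..K}" for k
    using that T_nonneg by (subst (asm) sum_nonneg_eq_0_iff) auto
  have "T (Suc K - j) = 0" if "j \<in> {1..K}" for j
    using that by (intro zero) auto
  then have "(\<Sum>j=1..K. T (Suc K - j) * pmf (map_pmf f (tree_of_order T j)) x) = 0"
    by (intro sum.neutral ballI) simp
  with True show ?thesis by simp
next
  case False
  let ?\<sigma> = "\<Sum>k=1..K. T k"
  from False have "(\<Sum>k=1..Suc K - 1. T k) \<noteq> 0" by simp
  note pmf_side_order = pmf_side_order[of T, OF T_nonneg this, simplified]
  let ?h = "\<lambda>j. map_pmf f (if j < Suc K then tree_of_order T j else return_pmf empty_tree)"
  have "pmf (map_pmf f (side_branch T (Suc K))) x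
      = (\<integral>j. pmf (?h j) x \<partial>side_order_pmf T (Suc K))"
    by (simp add: side_branch_def map_bind_pmf pmf_bind)
  also have "\<dots> = (\<Sum>j=1..K. pmf (side_order_pmf T (Suc K)) j *\<^sub>R pmf (?h j) x)"
    by (rule integral_measure_pmf)
      (auto simp: set_pmf_iff pmf_side_order split: if_splits)
  also have "\<dots> = (\<Sum>j=1..K. T (Suc K - j) / ?\<sigma> * pmf (map_pmf f (tree_of_order T j)) x)"
    by (intro sum.cong) (auto simp: pmf_side_order)
  finally show ?thesis
    using False by (simp add: sum_distrib_left)
qed

lemma side_branch_nonempty:
  assumes "(\<Sum>k=1..K. T k) \<noteq> 0" "t \<in> set_pmf (side_branch T (Suc K))"
  shows "t \<in> nonempty_trees"
proof -
  have "(\<Sum>k=1..K. T k) * pmf (side_branch T (Suc K)) t \<noteq> 0"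
    using assms by (simp add: set_pmf_iff)
  then have "(\<Sum>j=1..K. T (Suc K - j) * pmf (tree_of_order T j) t) \<noteq> 0"
    unfolding pmf_map_side_branch[of K id t, unfolded pmf.map_id] .
  then obtain j where "j \<in> {1..K}" "pmf (tree_of_order T j) t \<noteq> 0"
    by (metis (no_types, lifting) mult_zero_right sum.neutral)
  then show ?thesis
    using tree_of_order_nonempty[of t "j - 1"] by (simp add: set_pmf_iff)
qed

text \<open>
  A pruned side branch of order \<open>j\<close> on a branch of order \<open>K + 3\<close> has order \<open>j - 1\<close> and weight
  \<open>T ((K + 3) - j) = T ((K + 2) - (j - 1))\<close>, which is the weight of order \<open>j - 1\<close> on a branch of order
  \<open>K + 2\<close>. This is the hypothesis of the thinning lemma; the empty trees that the filter discards come
  from \<open>j = 1\<close>.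
\<close>
lemma prune_side_branches:
  assumes IH: "\<And>j. j < Suc (Suc K) \<Longrightarrow> map_pmf prune (tree_of_order T (Suc j)) = tree_of_order T j"
  shows "map_pmf (\<lambda>sides. filter (\<lambda>A. A \<noteq> empty_tree) (map prune sides))
           (geometric_list (\<Sum>k=1..Suc (Suc K). T k) (side_branch T (Suc (Suc (Suc K)))))
       = geometric_list (\<Sum>k=1..Suc K. T k) (side_branch T (Suc (Suc K)))"
proof -
  have dens: "(\<Sum>k=1..Suc (Suc K). T k) * (if x \<noteq> empty_tree
        then pmf (map_pmf prune (side_branch T (Suc (Suc (Suc K))))) x else 0)
      = (\<Sum>k=1..Suc K. T k) * pmf (side_branch T (Suc (Suc K))) x" for x
  proof (cases "x = empty_tree")
    case True
    then show ?thesis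
      using side_branch_nonempty[of "Suc K" x] by (auto simp: nonempty_trees_def set_pmf_iff)
  next
    case False
    have "(\<Sum>j=1..Suc (Suc K). T (Suc (Suc (Suc K)) - j) * pmf (map_pmf prune (tree_of_order T j)) x)
        = (\<Sum>i=0..Suc K. T (Suc (Suc K) - i) * pmf (tree_of_order T i) x)"
      unfolding One_nat_def sum.shift_bounds_cl_Suc_ivl
      by (intro sum.cong) (auto simp: IH simp del: diff_Suc_Suc)
    also have "\<dots> = (\<Sum>i=1..Suc K. T (Suc (Suc K) - i) * pmf (tree_of_order T i) x)"
      using False
      by (subst sum.atLeast_Suc_atMost) (auto simp: tree_of_order.simps[of T 0] pmf_return)
    finally show ?thesis
      using False pmf_map_side_branch[of "Suc (Suc K)" prune x] pmf_map_side_branch[of "Suc K" id x]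
      by (simp add: pmf.map_id del: sum.cl_ivl_Suc)
  qed
  have nonneg: "0 \<le> (\<Sum>k=1..n. T k)" for n
    by (intro sum_nonneg T_nonneg) auto
  show ?thesis
    unfolding filter_geometric_list[OF nonneg nonneg dens, symmetric] map_geometric_list[symmetric]
    by (simp add: pmf.map_comp o_def)
qed

text \<open>
  Orders 1 and 2 are separate because a tree of order 1 is a bare edge, not a branch that ends in two
  subtrees. In a tree of order at least 3 both final subtrees survive, and the pruned pieces have exactly
  the joint law of the pieces of a tree with order one less.
\<close>
theorem prune_tree_of_order: "map_pmf prune (tree_of_order T (Suc K)) = tree_of_order T K"
proof (induction K rule: less_induct)
  case (less K)
  have edge: "prune planted_edge = empty_tree"
    using is_ord_planted_edge(1) by simp
  have edge': "planted_edge \<in> nonempty_trees"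
    using is_ord_planted_edge by (simp add: nonempty_trees_def)
  have nonneg: "0 \<le> (\<Sum>k=1..n. T k)" for n
    by (intro sum_nonneg T_nonneg) auto
  have sides: "set sides \<subseteq> nonempty_trees"
    if "sides \<in> set_pmf (geometric_list (\<Sum>k=1..n. T k) (side_branch T (Suc n)))" for sides n
    using set_geometric_list[OF nonneg that] side_branch_nonempty by blast
  consider "K = 0" | "K = 1" | L where "K = Suc (Suc L)"
    by (metis One_nat_def old.nat.exhaust)
  then show ?case
  proof cases
    case 1
    then show ?thesis by (simp add: edge tree_of_order.simps)
  next
    \<comment> \<open>In a tree of order 2 everything attached to the leading branch is a single edge. All of it is cut, and what
      remains is the leading branch.\<close>
    case 2
    have "prune (foldr join sides (join planted_edge planted_edge)) = planted_edge"
      if "sides \<in> set_pmf (geometric_list (\<Sum>k=1..Suc 0. T k) (side_branch T (Suc (Suc 0))))" for sides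
    proof -
      have "set sides \<subseteq> {planted_edge}"
      proof
        fix A assume A: "A \<in> set sides"
        note sd = set_geometric_list[OF nonneg that A]
        have "T 1 * pmf (side_branch T (Suc (Suc 0))) A = T 1 * pmf (tree_of_order T 1) A"
          using pmf_map_side_branch[of "Suc 0" id A] by (simp add: pmf.map_id)
        then show "A \<in> {planted_edge}"
          using sd by (auto simp: set_pmf_iff tree_of_order_one indicator_def split: if_splits)
      qed
      then have "filter (\<lambda>A. A \<noteq> empty_tree) (map prune sides) = []"
        by (auto simp: edge filter_empty_conv)
      moreover have "prune (join planted_edge planted_edge) = planted_edge"
        using edge' by (simp add: prune_join nonempty_trees_def edge)
      moreover have "join planted_edge planted_edge \<in> nonempty_trees"
        using edge' by (simp add: join_nonempty)
      moreover have "planted_edge \<noteq> empty_tree"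
        using edge' by (simp add: nonempty_trees_def)
      ultimately show ?thesis
        using prune_foldr_join[of sides "join planted_edge planted_edge"] sides[OF that] by simp
    qed
    then have "map_pmf prune (tree_of_order T (Suc (Suc 0)))
        = geometric_list (\<Sum>k=1..Suc 0. T k) (side_branch T (Suc (Suc 0))) \<bind> (\<lambda>_. return_pmf planted_edge)"
      unfolding tree_of_order_branch tree_of_order_one
      by (simp add: map_bind_pmf bind_return_pmf cong: bind_pmf_cong)
    then show ?thesis
      using 2 by (simp add: tree_of_order_one)
  next
    case (3 L)
    let ?G = "\<lambda>n. geometric_list (\<Sum>k=1..Suc n. T k) (side_branch T (Suc (Suc n)))"
    let ?f = "\<lambda>sides. filter (\<lambda>A. A \<noteq> empty_tree) (map prune sides)"
    let ?t = "tree_of_order T"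
    have prune_pieces: "prune (foldr join sides (join a b)) = foldr join (?f sides) (join (prune a) (prune b))"
      if "sides \<in> set_pmf (?G (Suc L))" "a \<in> set_pmf (?t (Suc (Suc L)))" "b \<in> set_pmf (?t (Suc (Suc L)))"
      for sides a b
    proof -
      have ab: "a \<in> nonempty_trees" "b \<in> nonempty_trees"
        using that tree_of_order_nonempty by auto
      have "prune a \<noteq> empty_tree" "prune b \<noteq> empty_tree"
        using that tree_of_order_support[of T, OF T_nonneg] by fastforce+
      then have "prune (join a b) = join (prune a) (prune b)" "prune (join a b) \<noteq> empty_tree"
        using ab prune_join[of a b]
        by (auto simp: nonempty_trees_def join_not_empty_tree)
      then show ?thesis
        using prune_foldr_join[of sides "join a b"] sides[OF that(1)] ab join_nonempty by simp
    qed
    have "map_pmf prune (?t (Suc (Suc (Suc L)))) = ?G (Suc L) \<bind> (\<lambda>sides. ?t (Suc (Suc L)) \<bind> (\<lambda>a.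
        ?t (Suc (Suc L)) \<bind> (\<lambda>b. return_pmf (foldr join (?f sides) (join (prune a) (prune b))))))"
      by (subst tree_of_order_branch)
        (auto simp: map_bind_pmf prune_pieces simp del: sum.cl_ivl_Suc intro!: bind_pmf_cong)
    also have "\<dots> = map_pmf ?f (?G (Suc L)) \<bind> (\<lambda>sides. map_pmf prune (?t (Suc (Suc L))) \<bind> (\<lambda>a.
        map_pmf prune (?t (Suc (Suc L))) \<bind> (\<lambda>b. return_pmf (foldr join sides (join a b)))))"
      unfolding bind_map_pmf ..
    also have "map_pmf ?f (?G (Suc L)) = ?G L"
      using 3 less.IH by (intro prune_side_branches) auto
    also have "map_pmf prune (?t (Suc (Suc L))) = ?t (Suc L)"
      using 3 less.IH by simp
    finally show ?thesis
      unfolding 3 tree_of_order_branch[of T L] .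
  qed
qed

end

section \<open>Invariance of the geometric tree\<close>

theorem theorem1:
  fixes T :: "nat \<Rightarrow> real" and p :: real and t :: rtree
  assumes "\<And>k. 1 \<le> k \<Longrightarrow> 0 \<le> T k"
    and "0 < p" and "p < 1"
    and "t \<in> binary_trees"
  shows "\<P>(s in measure_pmf (map_pmf prune (geometric_tree T p)). s = t \<bar> s \<noteq> empty_tree)
           = pmf (geometric_tree T p) t"
proof -
  let ?\<mu> = "geometric_tree T p"
  let ?\<nu> = "map_pmf prune ?\<mu>"
  have p: "p \<in> {0<..1}" using assms by simp
  have "?\<nu> = geometric_pmf p \<bind> tree_of_order T"
    by (simp add: geometric_tree_def map_bind_pmf prune_tree_of_order[of T, OF assms(1)])
  \<comment> \<open>Lack of memory: either the order parameter is 0, or it is 1 plus a fresh copy.\<close>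
  also have "\<dots> = bernoulli_pmf p \<bind> (\<lambda>b. if b then return_pmf empty_tree else ?\<mu>)"
    by (subst geometric_bind_pmf_unfold[OF p])
      (auto simp: geometric_tree_def bind_assoc_pmf bind_return_pmf bind_map_pmf
        tree_of_order.simps[of T 0] intro!: bind_pmf_cong)
  finally have mixture: "?\<nu> = bernoulli_pmf p \<bind> (\<lambda>b. if b then return_pmf empty_tree else ?\<mu>)" .
  have pmf_\<nu>: "pmf ?\<nu> s = p * indicator {empty_tree} s + (1 - p) * pmf ?\<mu> s" for s
    unfolding mixture pmf_bind using assms by (subst integral_bernoulli_pmf) (auto simp: indicator_def)
  have \<mu>_empty: "pmf ?\<mu> empty_tree = 0"
    using geometric_tree_support(1)[of T p, OF assms(1)] by (auto simp: pmf_eq_0_set_pmf)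
  have "measure_pmf.prob ?\<nu> {s. s \<noteq> empty_tree} = 1 - pmf ?\<nu> empty_tree"
    using measure_pmf.prob_compl[of "{empty_tree}" ?\<nu>]
    by (simp add: measure_pmf_single Compl_eq_Diff_UNIV[symmetric] Collect_neg_eq)
  then have nonempty: "measure_pmf.prob ?\<nu> {s. s \<noteq> empty_tree} = 1 - p"
    by (simp add: pmf_\<nu> \<mu>_empty)
  show ?thesis
  proof (cases "t = empty_tree")
    case True
    then show ?thesis by (simp add: cond_prob_def \<mu>_empty)
  next
    case False
    then have "{s. s = t \<and> s \<noteq> empty_tree} = {t}" by auto
    then show ?thesis
      using False assms(3) by (simp add: cond_prob_def nonempty measure_pmf_single pmf_\<nu> del: measure_map_pmf)
  qed
qed

end
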